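(* Let $\alpha,\beta\in\mathbb{C}$ with $1<|\alpha|\le|\beta|$, let $M=M_{\alpha,\beta}$ be the associated primary Hopf surface of class 1, and let $\hat\omega=\sqrt{-1}\,\partial\overline{\partial}\Phi/\Phi$ be the Gauduchon–Ornea locally conformally Kähler metric on $M$. Then $\hat\omega$ satisfies the Gauduchon condition, that is, $\partial\overline{\partial}\hat\omega=0$.
   Context: $M_{\alpha,\beta}$ is the compact complex surface $(\mathbb{C}^2\setminus\{0\})/\sim$, the quotient by the group generated by $(z_1,z_2)\mapsto(\alpha z_1,\beta z_2)$. Set $k_1=\frac{\log|\alpha|}{\log|\alpha|+\log|\beta|}\le k_2=\frac{\log|\beta|}{\log|\alpha|+\log|\beta|}$. The function $\Phi>0$ on $\mathbb{C}^2\setminus\{0\}$ is defined as the unique positive solution of $$|z_1|^2\Phi^{-2k_1}+|z_2|^2\Phi^{-2k_2}=1 .$$ $\Phi$ does not descend to $M$, but the $(1,1)$-form $\hat\omega=\frac{\sqrt{-1}\,\partial\overline{\partial}\Phi}{\Phi}$ does descend and is positive definite, hence is the form of a Hermitian metric on $M$. On a complex surface, a Hermitian metric is called Gauduchon if its associated $(1,1)$-form $\omega$ satisfies $\partial\overline{\partial}\omega=0$. *)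

theory Defs
  imports "HOL-Analysis.Analysis"
begin

section \<open>Differential forms on open subsets of complex coordinate space\<close>

text \<open>A complex-valued form \<open>\<eta>\<close> assigns to a point \<open>z\<close> and a list \<open>[v\<^sub>1, \<dots>, v\<^sub>k]\<close> of real tangent
  vectors, identified with elements of \<open>complex ^ 'n\<close>, the value \<open>\<eta>\<^sub>z(v\<^sub>1, \<dots>, v\<^sub>k)\<close>. A form of pure
  degree \<open>k\<close> takes the value 0 on all lists whose length is not \<open>k\<close>.\<close>

type_synonym 'n form = "complex ^ 'n \<Rightarrow> (complex ^ 'n) list \<Rightarrow> complex"

definition form_of_fun :: "(complex ^ 'n \<Rightarrow> complex) \<Rightarrow> 'n form" where
  "form_of_fun f z vs = (if vs = [] then f z else 0)"

text \<open>The complex linear and complex antilinear parts of the real differential of \<open>f\<close>: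
  \<open>\<Sum>\<^sub>j (\<partial>f/\<partial>z\<^sub>j) dz\<^sub>j(v)\<close> and \<open>\<Sum>\<^sub>j (\<partial>f/\<partial>cnj z\<^sub>j) cnj (dz\<^sub>j(v))\<close>.\<close>

definition diff_lin :: "(complex ^ 'n::finite \<Rightarrow> complex) \<Rightarrow> complex ^ 'n \<Rightarrow> complex ^ 'n \<Rightarrow> complex" where
  "diff_lin f z v =
     (frechet_derivative f (at z) v - \<i> * frechet_derivative f (at z) (\<i> *s v)) / 2"

definition diff_antilin :: "(complex ^ 'n::finite \<Rightarrow> complex) \<Rightarrow> complex ^ 'n \<Rightarrow> complex ^ 'n \<Rightarrow> complex" where
  "diff_antilin f z v =
     (frechet_derivative f (at z) v + \<i> * frechet_derivative f (at z) (\<i> *s v)) / 2"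

text \<open>\<open>\<partial>\<eta> = \<Sum>\<^sub>j dz\<^sub>j \<and> \<partial>\<eta>/\<partial>z\<^sub>j\<close> and its conjugate counterpart, evaluated on tangent vectors, with the
  convention \<open>(\<theta> \<and> \<eta>)(v\<^sub>0, \<dots>, v\<^sub>k) = \<Sum>\<^sub>i (-1)\<^sup>i \<theta>(v\<^sub>i) \<eta>(v\<^sub>0, \<dots>, v\<^sub>i omitted, \<dots>, v\<^sub>k)\<close> for a 1-form \<open>\<theta>\<close>.\<close>

definition del :: "('n::finite) form \<Rightarrow> 'n form" where
  "del \<eta> z vs = (\<Sum>i<length vs.
     (-1) ^ i * diff_lin (\<lambda>w. \<eta> w (take i vs @ drop (Suc i) vs)) z (vs ! i))"

definition delbar :: "('n::finite) form \<Rightarrow> 'n form" where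
  "delbar \<eta> z vs = (\<Sum>i<length vs.
     (-1) ^ i * diff_antilin (\<lambda>w. \<eta> w (take i vs @ drop (Suc i) vs)) z (vs ! i))"


section \<open>Forms on complex manifolds\<close>

text \<open>A chart is a pair of its domain and its coordinate map. A form on a manifold with a given
  holomorphic atlas is the family of its coordinate expressions in the charts of the atlas.
  Since \<^const>\<open>del\<close> and \<^const>\<open>delbar\<close> commute with holomorphic coordinate changes, they act on
  such families chart by chart.\<close>

type_synonym ('a, 'n) chart = "'a set \<times> ('a \<Rightarrow> complex ^ 'n)"
type_synonym ('a, 'n) mform = "('a, 'n) chart \<Rightarrow> 'n form"

definition mdel :: "('a, 'n::finite) mform \<Rightarrow> ('a, 'n) mform" where
  "mdel \<omega> c = del (\<omega> c)"

definition mdelbar :: "('a, 'n::finite) mform \<Rightarrow> ('a, 'n) mform" where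
  "mdelbar \<omega> c = delbar (\<omega> c)"

definition mform_vanishes :: "('a, 'n) chart set \<Rightarrow> ('a, 'n) mform \<Rightarrow> bool" where
  "mform_vanishes A \<omega> \<longleftrightarrow> (\<forall>(W, \<phi>) \<in> A. \<forall>x \<in> \<phi> ` W. \<forall>vs. \<omega> (W, \<phi>) x vs = 0)"

text \<open>The Gauduchon condition \<open>\<partial>\<partial>bar \<omega> = 0\<close> for the (1,1)-form of a Hermitian metric on a
  complex surface.\<close>

definition gauduchon_condition :: "('a, 2) chart set \<Rightarrow> ('a, 2) mform \<Rightarrow> bool" where
  "gauduchon_condition A \<omega> \<longleftrightarrow> mform_vanishes A (mdel (mdelbar \<omega>))"

text \<open>The form on the base of a holomorphic covering \<open>p : X \<rightarrow> M\<close> to which a form \<open>\<eta>\<close> on \<open>X\<close>,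
  invariant under deck transformations, descends. At the point with coordinates \<open>x\<close> in the chart
  \<open>(W, \<phi>)\<close>, choose a preimage \<open>z\<close> under \<open>\<phi> \<circ> p\<close> and transport tangent vectors to \<open>z\<close> by the
  inverse of the differential of \<open>\<phi> \<circ> p\<close>; by invariance the result does not depend on \<open>z\<close>.\<close>

definition descend :: "(complex ^ 'n::finite \<Rightarrow> 'a) \<Rightarrow> (complex ^ 'n) set \<Rightarrow> 'n form \<Rightarrow> ('a, 'n) mform" where
  "descend p X \<eta> = (\<lambda>(W, \<phi>) x vs.
     let z = (SOME z. z \<in> X \<and> p z \<in> W \<and> \<phi> (p z) = x)
     in \<eta> z (map (inv (frechet_derivative (\<phi> \<circ> p) (at z))) vs))"


section \<open>Primary Hopf surfaces of class 1\<close>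

definition hopf_act :: "complex \<Rightarrow> complex \<Rightarrow> int \<Rightarrow> complex ^ 2 \<Rightarrow> complex ^ 2" where
  "hopf_act \<alpha> \<beta> n z = vector [\<alpha> powi n * z $ 1, \<beta> powi n * z $ 2]"

definition hopf_rel :: "complex \<Rightarrow> complex \<Rightarrow> ((complex ^ 2) \<times> (complex ^ 2)) set" where
  "hopf_rel \<alpha> \<beta> = {(z, w). z \<noteq> 0 \<and> w \<noteq> 0 \<and> (\<exists>n. w = hopf_act \<alpha> \<beta> n z)}"

definition hopf_surface :: "complex \<Rightarrow> complex \<Rightarrow> (complex ^ 2) set set" where
  "hopf_surface \<alpha> \<beta> = (UNIV - {0}) // hopf_rel \<alpha> \<beta>"

definition hopf_proj :: "complex \<Rightarrow> complex \<Rightarrow> complex ^ 2 \<Rightarrow> (complex ^ 2) set" where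
  "hopf_proj \<alpha> \<beta> z = hopf_rel \<alpha> \<beta> `` {z}"

text \<open>The complex structure of the quotient: the charts are the inverses of the restrictions of the
  projection to open sets on which it is injective.\<close>

definition hopf_atlas :: "complex \<Rightarrow> complex \<Rightarrow> ((complex ^ 2) set, 2) chart set" where
  "hopf_atlas \<alpha> \<beta> = {(hopf_proj \<alpha> \<beta> ` U, inv_into U (hopf_proj \<alpha> \<beta>)) | U.
     open U \<and> 0 \<notin> U \<and> inj_on (hopf_proj \<alpha> \<beta>) U}"

lemma hopf_act_nth [simp]:
  "hopf_act \<alpha> \<beta> n z $ 1 = \<alpha> powi n * z $ 1"
  "hopf_act \<alpha> \<beta> n z $ 2 = \<beta> powi n * z $ 2"
  by (simp_all add: hopf_act_def)

lemma vec2_eq_iff: "z = w \<longleftrightarrow> z $ 1 = w $ 1 \<and> z $ 2 = w $ 2" for z w :: "complex ^ 2"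
  by (simp add: vec_eq_iff forall_2)

lemma equiv_hopf_rel:
  assumes "\<alpha> \<noteq> 0" "\<beta> \<noteq> 0"
  shows "equiv (UNIV - {0}) (hopf_rel \<alpha> \<beta>)"
proof (rule equivI)
  show "hopf_rel \<alpha> \<beta> \<subseteq> (UNIV - {0}) \<times> (UNIV - {0})"
    by (auto simp: hopf_rel_def)
  show "refl_on (UNIV - {0}) (hopf_rel \<alpha> \<beta>)"
    by (auto simp: refl_on_def hopf_rel_def vec2_eq_iff intro!: exI[of _ 0])
  show "sym (hopf_rel \<alpha> \<beta>)"
  proof (rule symI)
    fix z w assume "(z, w) \<in> hopf_rel \<alpha> \<beta>"
    then obtain n where "z \<noteq> 0" "w \<noteq> 0" "w = hopf_act \<alpha> \<beta> n z"
      by (auto simp: hopf_rel_def)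
    moreover from this(3) have "z = hopf_act \<alpha> \<beta> (- n) w"
      using assms by (simp add: vec2_eq_iff power_int_minus)
    ultimately show "(w, z) \<in> hopf_rel \<alpha> \<beta>"
      unfolding hopf_rel_def by blast
  qed
  show "trans (hopf_rel \<alpha> \<beta>)"
  proof (rule transI)
    fix u z w assume "(u, z) \<in> hopf_rel \<alpha> \<beta>" "(z, w) \<in> hopf_rel \<alpha> \<beta>"
    then obtain n m where h: "u \<noteq> 0" "w \<noteq> 0" "z = hopf_act \<alpha> \<beta> n u" "w = hopf_act \<alpha> \<beta> m z"
      by (auto simp: hopf_rel_def)
    have "w = hopf_act \<alpha> \<beta> (m + n) u"
      using assms unfolding h(4) h(3) by (simp add: vec2_eq_iff power_int_add mult_ac)
    then show "(u, w) \<in> hopf_rel \<alpha> \<beta>"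
      using h unfolding hopf_rel_def by blast
  qed
qed

lemma hopf_proj_eq_iff:
  assumes "\<alpha> \<noteq> 0" "\<beta> \<noteq> 0" "z \<noteq> 0" "w \<noteq> 0"
  shows "hopf_proj \<alpha> \<beta> z = hopf_proj \<alpha> \<beta> w \<longleftrightarrow> (\<exists>n. w = hopf_act \<alpha> \<beta> n z)"
  unfolding hopf_proj_def
  using eq_equiv_class_iff[OF equiv_hopf_rel[OF assms(1,2)], of z w] assms(3,4)
  by (auto simp: hopf_rel_def)

lemma powi_annulus:
  fixes c :: complex and t s r :: real
  assumes c: "1 < cmod c" and "r > 0" and t: "r < t" "t < cmod c * r"
    and s: "r < s" "s < cmod c * r" and eq: "s = cmod c powi n * t"
  shows "n = 0"
proof (rule ccontr)
  have c0: "cmod c \<noteq> 0" using c by linarith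
  assume "n \<noteq> 0"
  then consider "1 \<le> n" | "n \<le> -1" by linarith
  then show False
  proof cases
    case 1
    then have "cmod c powi 1 \<le> cmod c powi n"
      using c by (intro power_int_increasing) auto
    then have "cmod c * r < s"
      unfolding eq using t \<open>r > 0\<close> c
      by (smt (verit) mult_less_le_imp_less power_int_1_right mult_mono mult_strict_left_mono)
    then show False using s by simp
  next
    case 2
    then have "cmod c powi n \<le> cmod c powi (-1)"
      using c by (intro power_int_increasing) auto
    then have "s \<le> inverse (cmod c) * t"
      unfolding eq using t \<open>r > 0\<close> by (intro mult_right_mono) (auto simp: power_int_minus)
    also have "\<dots> < r"
      using t c c0 by (simp add: field_simps)
    finally show False using s by simp
  qed
qed

text \<open>The chart domains cover the Hopf surface, and coordinate changes are locally given by the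
  linear maps in the group generated by \<open>(z\<^sub>1, z\<^sub>2) \<mapsto> (\<alpha> z\<^sub>1, \<beta> z\<^sub>2)\<close>.\<close>

lemma hopf_atlas_covers:
  assumes "1 < cmod \<alpha>" "1 < cmod \<beta>"
  shows "(\<Union>(W, \<phi>) \<in> hopf_atlas \<alpha> \<beta>. W) = hopf_surface \<alpha> \<beta>"
proof
  show "(\<Union>(W, \<phi>) \<in> hopf_atlas \<alpha> \<beta>. W) \<subseteq> hopf_surface \<alpha> \<beta>"
    by (auto simp: hopf_atlas_def hopf_surface_def hopf_proj_def intro!: quotientI)
next
  have nz: "\<alpha> \<noteq> 0" "\<beta> \<noteq> 0" using assms by auto
  have main: "\<exists>U. open U \<and> 0 \<notin> U \<and> inj_on (hopf_proj \<alpha> \<beta>) U \<and> z \<in> U"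
    if i: "z $ i \<noteq> 0" and c: "1 < cmod c"
      and act: "\<And>n w. hopf_act \<alpha> \<beta> n w $ i = c powi n * w $ i" for z :: "complex ^ 2" and i c
  proof -
    define r where "r = cmod (z $ i) / sqrt (cmod c)"
    have sq: "1 < sqrt (cmod c)" using c by simp
    have r0: "r > 0" unfolding r_def using i sq by (intro divide_pos_pos) auto
    have cr: "cmod c * r = sqrt (cmod c) * cmod (z $ i)"
    proof -
      have "cmod c = sqrt (cmod c) * sqrt (cmod c)" by simp
      then have "cmod c * r = sqrt (cmod c) * (sqrt (cmod c) * r)" by (metis mult.assoc)
      moreover have "sqrt (cmod c) * r = cmod (z $ i)" using sq unfolding r_def by auto
      ultimately show ?thesis by simp
    qed
    define U where "U = {w :: complex ^ 2. r < cmod (w $ i) \<and> cmod (w $ i) < cmod c * r}"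
    have "open U"
      unfolding U_def by (intro open_Collect_conj open_Collect_less continuous_intros)
    moreover have U0: "0 \<notin> U" using r0 by (simp add: U_def)
    moreover have "z \<in> U"
    proof -
      have "cmod (z $ i) / sqrt (cmod c) < cmod (z $ i) / 1"
        using i sq by (intro divide_strict_left_mono) auto
      moreover have "1 * cmod (z $ i) < sqrt (cmod c) * cmod (z $ i)"
        using i sq by (intro mult_strict_right_mono) auto
      ultimately show ?thesis unfolding U_def cr by (simp add: r_def)
    qed
    moreover have "inj_on (hopf_proj \<alpha> \<beta>) U"
    proof (rule inj_onI)
      fix u w assume uw: "u \<in> U" "w \<in> U" "hopf_proj \<alpha> \<beta> u = hopf_proj \<alpha> \<beta> w"
      then have "u \<noteq> 0" "w \<noteq> 0" using U0 by auto
      then obtain n where n: "w = hopf_act \<alpha> \<beta> n u"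
        using uw hopf_proj_eq_iff[OF nz] by blast
      have "cmod (w $ i) = cmod c powi n * cmod (u $ i)"
        by (simp add: n act norm_mult norm_power_int)
      then have "n = 0"
        using uw r0 c by (intro powi_annulus[of c r "cmod (u $ i)" "cmod (w $ i)"]) (auto simp: U_def)
      then show "u = w" using n by (simp add: vec2_eq_iff)
    qed
    ultimately show ?thesis by blast
  qed
  show "hopf_surface \<alpha> \<beta> \<subseteq> (\<Union>(W, \<phi>) \<in> hopf_atlas \<alpha> \<beta>. W)"
  proof
    fix q assume "q \<in> hopf_surface \<alpha> \<beta>"
    then obtain z where z: "z \<noteq> 0" "q = hopf_proj \<alpha> \<beta> z"
      by (auto simp: hopf_surface_def hopf_proj_def quotient_def)
    then have "z $ 1 \<noteq> 0 \<or> z $ 2 \<noteq> 0" by (simp add: vec2_eq_iff)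
    then obtain U where "open U" "0 \<notin> U" "inj_on (hopf_proj \<alpha> \<beta>) U" "z \<in> U"
      using main[of z 1 \<alpha>] main[of z 2 \<beta>] assms by auto
    then show "q \<in> (\<Union>(W, \<phi>) \<in> hopf_atlas \<alpha> \<beta>. W)"
      using z(2) unfolding hopf_atlas_def by blast
  qed
qed

lemma hopf_act_continuous [continuous_intros]: "continuous_on S (hopf_act \<alpha> \<beta> n)"
proof -
  have "hopf_act \<alpha> \<beta> n = (\<lambda>z. \<chi> i. (if i = 1 then \<alpha> powi n else \<beta> powi n) * z $ i)"
    by (rule ext) (simp add: vec2_eq_iff)
  then show ?thesis
    by (simp only:) (intro continuous_intros)
qed

lemma hopf_atlas_transition:
  assumes "\<alpha> \<noteq> 0" "\<beta> \<noteq> 0" "(W, \<phi>) \<in> hopf_atlas \<alpha> \<beta>" "(W', \<phi>') \<in> hopf_atlas \<alpha> \<beta>"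
    and q: "q \<in> W \<inter> W'"
  shows "\<exists>n. \<forall>\<^sub>F x in nhds (\<phi> q).
    x \<in> \<phi> ` (W \<inter> W') \<and> \<phi>' (inv_into W \<phi> x) = hopf_act \<alpha> \<beta> n x"
proof -
  let ?p = "hopf_proj \<alpha> \<beta>"
  obtain U where U: "W = ?p ` U" "\<phi> = inv_into U ?p" "open U" "0 \<notin> U" "inj_on ?p U"
    using assms(3) by (auto simp: hopf_atlas_def)
  obtain U' where U': "W' = ?p ` U'" "\<phi>' = inv_into U' ?p" "open U'" "0 \<notin> U'" "inj_on ?p U'"
    using assms(4) by (auto simp: hopf_atlas_def)
  obtain z where z: "z \<in> U" "q = ?p z" using q U by auto
  obtain z' where z': "z' \<in> U'" "q = ?p z'" using q U' by auto
  have "z \<noteq> 0" "z' \<noteq> 0" using z z' U U' by auto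
  then obtain n where n: "z' = hopf_act \<alpha> \<beta> n z"
    using z z' hopf_proj_eq_iff[OF assms(1,2)] by metis
  have \<phi>q: "\<phi> q = z" using U z by simp
  define V where "V = U \<inter> hopf_act \<alpha> \<beta> n -` U'"
  have "open V"
    unfolding V_def using U U' by (intro open_Int open_vimage continuous_intros) auto
  moreover have "z \<in> V" using z z' n by (simp add: V_def)
  moreover have "x \<in> \<phi> ` (W \<inter> W') \<and> \<phi>' (inv_into W \<phi> x) = hopf_act \<alpha> \<beta> n x" if "x \<in> V" for x
  proof -
    have x: "x \<in> U" "hopf_act \<alpha> \<beta> n x \<in> U'" using that by (auto simp: V_def)
    then have "x \<noteq> 0" "hopf_act \<alpha> \<beta> n x \<noteq> 0" using U U' by auto
    then have px: "?p x = ?p (hopf_act \<alpha> \<beta> n x)"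
      using hopf_proj_eq_iff[OF assms(1,2)] by blast
    have \<phi>x: "\<phi> (?p x) = x" using U x by simp
    have pW: "?p x \<in> W \<inter> W'" using U U' x px by auto
    have "inj_on \<phi> W" unfolding U by (simp add: inj_on_inv_into)
    then have "inv_into W \<phi> x = ?p x"
      using pW \<phi>x inv_into_f_f[of \<phi> W "?p x"] by auto
    moreover have "\<phi>' (?p x) = hopf_act \<alpha> \<beta> n x"
      unfolding px using U' x by simp
    ultimately show ?thesis using pW \<phi>x by force
  qed
  ultimately show ?thesis
    unfolding \<phi>q eventually_nhds by blast
qed

text \<open>For a form on the covering that is invariant under deck transformations, the coordinate
  expression of the descended form in a chart given by a local inverse of the projection is the
  form itself.\<close>

lemma hopf_act_has_derivative: "(hopf_act \<alpha> \<beta> n has_derivative hopf_act \<alpha> \<beta> n) (at z)"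
proof -
  have eq: "hopf_act \<alpha> \<beta> n = (\<lambda>z. \<chi> i. (if i = 1 then \<alpha> powi n else \<beta> powi n) * z $ i)"
    by (rule ext) (simp add: vec2_eq_iff)
  have "bounded_linear (hopf_act \<alpha> \<beta> n)"
    unfolding linear_conv_bounded_linear[symmetric] eq
    by (rule linearI) (auto simp: vec_eq_iff algebra_simps)
  then show ?thesis by (rule bounded_linear_imp_has_derivative)
qed

lemma descend_hopf_proj:
  assumes nz: "\<alpha> \<noteq> 0" "\<beta> \<noteq> 0"
    and inv: "\<And>n z vs. z \<noteq> 0 \<Longrightarrow> \<eta> (hopf_act \<alpha> \<beta> n z) (map (hopf_act \<alpha> \<beta> n) vs) = \<eta> z vs"
    and U: "open U" "0 \<notin> U" "inj_on (hopf_proj \<alpha> \<beta>) U" and x: "x \<in> U"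
  shows "descend (hopf_proj \<alpha> \<beta>) (UNIV - {0}) \<eta>
    (hopf_proj \<alpha> \<beta> ` U, inv_into U (hopf_proj \<alpha> \<beta>)) x vs = \<eta> x vs"
proof -
  let ?p = "hopf_proj \<alpha> \<beta>"
  let ?P = "\<lambda>z. z \<in> UNIV - {0} \<and> ?p z \<in> ?p ` U \<and> inv_into U ?p (?p z) = x"
  define z where "z = (SOME z. ?P z)"
  have x0: "x \<noteq> 0" using x U by auto
  have "?P x" using x x0 U by simp
  then have z: "?P z" unfolding z_def by (rule someI)
  then have z0: "z \<noteq> 0" and pz: "?p z = ?p x"
    using f_inv_into_f[of "?p z" ?p U] by auto
  obtain n where n: "x = hopf_act \<alpha> \<beta> n z"
    using hopf_proj_eq_iff[OF nz z0 x0] pz by auto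
  have act_cancel: "hopf_act \<alpha> \<beta> (- n) (hopf_act \<alpha> \<beta> n w) = w"
    "hopf_act \<alpha> \<beta> n (hopf_act \<alpha> \<beta> (- n) w) = w" for w
    using nz by (simp_all add: vec2_eq_iff power_int_minus)
  have "open (hopf_act \<alpha> \<beta> n -` U)" using U by (intro open_vimage continuous_intros)
  moreover have "z \<in> hopf_act \<alpha> \<beta> n -` U" using x n by simp
  moreover have "hopf_act \<alpha> \<beta> n w = (inv_into U ?p \<circ> ?p) w"
    if "w \<in> hopf_act \<alpha> \<beta> n -` U" for w
  proof -
    have w: "hopf_act \<alpha> \<beta> n w \<in> U" using that by simp
    then have w0: "hopf_act \<alpha> \<beta> n w \<noteq> 0" using U by auto
    then have "w \<noteq> 0" by (auto simp: vec2_eq_iff)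
    then have "?p w = ?p (hopf_act \<alpha> \<beta> n w)"
      using hopf_proj_eq_iff[OF nz] w0 by blast
    then show ?thesis using w U by simp
  qed
  ultimately have "((inv_into U ?p \<circ> ?p) has_derivative hopf_act \<alpha> \<beta> n) (at z)"
    by (rule has_derivative_transform_within_open[OF hopf_act_has_derivative])
  then have "frechet_derivative (inv_into U ?p \<circ> ?p) (at z) = hopf_act \<alpha> \<beta> n"
    by (rule frechet_derivative_at[symmetric])
  moreover have "inv (hopf_act \<alpha> \<beta> n) = hopf_act \<alpha> \<beta> (- n)"
    by (rule inv_equality) (simp_all add: act_cancel)
  ultimately have "descend ?p (UNIV - {0}) \<eta> (?p ` U, inv_into U ?p) x vs =
      \<eta> z (map (hopf_act \<alpha> \<beta> (- n)) vs)"
    unfolding descend_def by (simp add: Let_def z_def)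
  also have "\<dots> = \<eta> x vs"
    using inv[OF z0, of n "map (hopf_act \<alpha> \<beta> (- n)) vs"]
    by (simp add: n o_def act_cancel)
  finally show ?thesis .
qed


section \<open>The Gauduchon-Ornea metric\<close>

definition hopf_k1 :: "complex \<Rightarrow> complex \<Rightarrow> real" where
  "hopf_k1 \<alpha> \<beta> = ln (cmod \<alpha>) / (ln (cmod \<alpha>) + ln (cmod \<beta>))"

definition hopf_k2 :: "complex \<Rightarrow> complex \<Rightarrow> real" where
  "hopf_k2 \<alpha> \<beta> = ln (cmod \<beta>) / (ln (cmod \<alpha>) + ln (cmod \<beta>))"

definition hopf_phi :: "complex \<Rightarrow> complex \<Rightarrow> complex ^ 2 \<Rightarrow> real" where
  "hopf_phi \<alpha> \<beta> z = (THE t. t > 0 \<and>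
     (cmod (z $ 1))\<^sup>2 * t powr (- 2 * hopf_k1 \<alpha> \<beta>) +
     (cmod (z $ 2))\<^sup>2 * t powr (- 2 * hopf_k2 \<alpha> \<beta>) = 1)"

text \<open>The form \<open>\<i> \<partial>\<partial>bar \<Phi> / \<Phi>\<close> on the universal covering, and the form it induces on the Hopf
  surface.\<close>

definition hopf_cover_form :: "complex \<Rightarrow> complex \<Rightarrow> 2 form" where
  "hopf_cover_form \<alpha> \<beta> z vs =
     \<i> * del (delbar (form_of_fun (\<lambda>w. of_real (hopf_phi \<alpha> \<beta> w)))) z vs / of_real (hopf_phi \<alpha> \<beta> z)"

definition gauduchon_ornea_form :: "complex \<Rightarrow> complex \<Rightarrow> ((complex ^ 2) set, 2) mform" where
  "gauduchon_ornea_form \<alpha> \<beta> =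
     descend (hopf_proj \<alpha> \<beta>) (UNIV - {0}) (hopf_cover_form \<alpha> \<beta>)"

lemma hopf_phi_ex1:
  fixes z :: "complex ^ 2"
  assumes "1 < cmod \<alpha>" "1 < cmod \<beta>" "z \<noteq> 0"
  shows "\<exists>!t. t > 0 \<and>
     (cmod (z $ 1))\<^sup>2 * t powr (- 2 * hopf_k1 \<alpha> \<beta>) +
     (cmod (z $ 2))\<^sup>2 * t powr (- 2 * hopf_k2 \<alpha> \<beta>) = 1"
proof -
  define a b where "a = (cmod (z $ 1))\<^sup>2" and "b = (cmod (z $ 2))\<^sup>2"
  define k l where "k = 2 * hopf_k1 \<alpha> \<beta>" and "l = 2 * hopf_k2 \<alpha> \<beta>"
  have kl: "k > 0" "l > 0"
    using assms by (auto simp: k_def l_def hopf_k1_def hopf_k2_def intro!: divide_pos_pos add_pos_pos ln_gt_zero)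
  have ab: "a \<ge> 0" "b \<ge> 0" "a > 0 \<or> b > 0"
    using assms(3) by (auto simp: a_def b_def vec2_eq_iff)
  define F where "F t = a * t powr (- k) + b * t powr (- l)" for t :: real
  have mono: "F t < F s" if "0 < s" "s < t" for s t
  proof -
    have 1: "t powr (- k) < s powr (- k)" "t powr (- l) < s powr (- l)"
      using that kl by (auto intro!: powr_less_mono2_neg)
    from ab(3) show ?thesis
    proof
      assume "a > 0"
      then show ?thesis unfolding F_def
        using 1 ab by (intro add_less_le_mono mult_strict_left_mono mult_left_mono) auto
    next
      assume "b > 0"
      then show ?thesis unfolding F_def
        using 1 ab by (intro add_le_less_mono mult_strict_left_mono mult_left_mono) auto
    qed
  qed
  have uniq: "s = t" if "s > 0" "t > 0" "F s = 1" "F t = 1" for s t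
    using mono[of s t] mono[of t s] that by linarith
  have lim: "((\<lambda>t. t powr (- m)) \<longlongrightarrow> 0) at_top" if "m > 0" for m :: real
    using that by (intro tendsto_neg_powr filterlim_ident) auto
  have "(F \<longlongrightarrow> a * 0 + b * 0) at_top"
    unfolding F_def using kl by (intro tendsto_intros lim)
  then have "\<forall>\<^sub>F t in at_top. F t < 1"
    by (intro order_tendstoD(2)[of F 0]) auto
  then have "\<forall>\<^sub>F t in at_top. F t < 1 \<and> t \<ge> 1"
    using eventually_ge_at_top by (rule eventually_conj)
  then obtain t1 where t1: "F t1 < 1" "t1 \<ge> 1"
    by (auto simp: eventually_at_top_linorder)
  have "\<exists>t0 > 0. t0 \<le> 1 \<and> F t0 \<ge> 1"
  proof -
    have ex: "\<exists>t0 > 0. t0 \<le> 1 \<and> c * t0 powr (- m) \<ge> 1" if "c > 0" "m > 0" for c m :: real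
    proof (intro exI conjI)
      let ?t = "min 1 (c powr (1 / m))"
      show "?t > 0" "?t \<le> 1" using that by auto
      have "c * (c powr (1 / m)) powr (- m) = 1"
        using that by (simp add: powr_powr powr_minus)
      moreover have "(c powr (1 / m)) powr (- m) \<le> ?t powr (- m)"
        using that by (intro powr_mono2') auto
      ultimately show "c * ?t powr (- m) \<ge> 1"
        using that by (metis mult_left_mono less_imp_le)
    qed
    from ab(3) show ?thesis
    proof
      assume "a > 0"
      with ex[of a k] kl obtain t0 where "t0 > 0" "t0 \<le> 1" "a * t0 powr (- k) \<ge> 1" by auto
      moreover have "b * t0 powr (- l) \<ge> 0" using ab by simp
      ultimately show ?thesis unfolding F_def by (intro exI[of _ t0]) auto
    next
      assume "b > 0"
      with ex[of b l] kl obtain t0 where "t0 > 0" "t0 \<le> 1" "b * t0 powr (- l) \<ge> 1" by auto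
      moreover have "a * t0 powr (- k) \<ge> 0" using ab by simp
      ultimately show ?thesis unfolding F_def by (intro exI[of _ t0]) auto
    qed
  qed
  then obtain t0 where t0: "t0 > 0" "t0 \<le> 1" "F t0 \<ge> 1" by auto
  have "continuous_on {t0..t1} F"
    unfolding F_def using t0 by (intro continuous_intros) auto
  then have "\<exists>t \<ge> t0. t \<le> t1 \<and> F t = 1"
    using t0 t1 by (intro IVT2') auto
  then obtain t where "t > 0" "F t = 1" using t0 by (meson less_le_trans)
  then have "\<exists>!t. t > 0 \<and> F t = 1" using uniq by blast
  then show ?thesis
    by (simp add: F_def a_def b_def k_def l_def)
qed

end

theory Submission
  imports Defs
begin

text \<open>
  Put \<open>u = log \<Phi>\<close>. Since \<open>\<Phi>\<close> is homogeneous under the flow of the holomorphic vector field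
  \<open>k\<^sub>1 z\<^sub>1 \<partial>\<^sub>1 + k\<^sub>2 z\<^sub>2 \<partial>\<^sub>2\<close>, the form \<open>\<partial>\<partial>bar u\<close> is degenerate along it; explicitly
  \<open>\<partial>\<partial>bar u = c \<sigma> \<and> cnj \<sigma>\<close> with \<open>\<sigma> = k\<^sub>2 z\<^sub>2 dz\<^sub>1 - k\<^sub>1 z\<^sub>1 dz\<^sub>2\<close>, so that \<open>(\<partial>\<partial>bar u)\<^sup>2 = 0\<close>.
  Now \<open>\<partial>\<partial>bar \<Phi> / \<Phi> = \<partial>\<partial>bar u + \<partial>u \<and> \<partial>bar u\<close>, and applying \<open>\<partial>\<partial>bar\<close> leaves, up to sign, only
  \<open>(\<partial>\<partial>bar u)\<^sup>2\<close>. Using the explicit formula for \<open>\<partial>\<partial>bar u\<close>, one never differentiates more than once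
  at a time; closedness of \<open>\<partial>u\<close> and \<open>\<partial>\<partial>bar u\<close> becomes a symmetry of first derivatives.
\<close>

section \<open>Wirtinger derivatives\<close>

text \<open>Carrying the complex linear part \<open>L\<close> and the antilinear part
  \<open>M\<close> together makes the calculus rules compose like those of
  \<open>has_derivative\<close>; conjugation swaps the two.\<close>

definition has_wirtinger ::
  "(complex ^ 'n::finite \<Rightarrow> complex) \<Rightarrow> (complex ^ 'n \<Rightarrow> complex) \<Rightarrow> (complex ^ 'n \<Rightarrow> complex)
    \<Rightarrow> complex ^ 'n \<Rightarrow> bool" where
  "has_wirtinger f L M z \<longleftrightarrow> (f has_derivative (\<lambda>v. L v + M v)) (at z) \<and>
     (\<forall>v. L (\<i> *s v) = \<i> * L v) \<and> (\<forall>v. M (\<i> *s v) = - \<i> * M v)"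

text \<open>In the combination defining \<open>diff_lin\<close>, the \<open>M\<close> terms cancel
  and the \<open>L\<close> terms double.\<close>

lemma diff_lin_eq: "has_wirtinger f L M z \<Longrightarrow> diff_lin f z v = L v"
  unfolding has_wirtinger_def diff_lin_def
  by (auto dest!: frechet_derivative_at[symmetric] simp: algebra_simps)

lemma diff_antilin_eq: "has_wirtinger f L M z \<Longrightarrow> diff_antilin f z v = M v"
  unfolding has_wirtinger_def diff_antilin_def
  by (auto dest!: frechet_derivative_at[symmetric] simp: algebra_simps)

lemma has_wirtinger_cong:
  assumes "has_wirtinger f L M z" "\<And>v. L v = L' v" "\<And>v. M v = M' v"
  shows "has_wirtinger f L' M' z"
proof -
  have "L = L'" "M = M'" using assms by auto
  then show ?thesis using assms(1) by simp
qed

lemma has_wirtinger_transform: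
  assumes "has_wirtinger f L M z" "open S" "z \<in> S" "\<And>w. w \<in> S \<Longrightarrow> f w = g w"
  shows "has_wirtinger g L M z"
  using assms has_derivative_transform_within_open[of f _ z UNIV S g]
  unfolding has_wirtinger_def by auto

lemma has_wirtinger_const: "has_wirtinger (\<lambda>z. k) (\<lambda>v. 0) (\<lambda>v. 0) z"
  by (simp add: has_wirtinger_def)

lemma has_wirtinger_nth: "has_wirtinger (\<lambda>z. z $ i) (\<lambda>v. v $ i) (\<lambda>v. 0) z"
  by (simp add: has_wirtinger_def bounded_linear_imp_has_derivative bounded_linear_vec_nth)

lemma has_wirtinger_cnj:
  assumes "has_wirtinger f L M z"
  shows "has_wirtinger (\<lambda>z. cnj (f z)) (\<lambda>v. cnj (M v)) (\<lambda>v. cnj (L v)) z"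
  using assms unfolding has_wirtinger_def
  by (auto intro!: derivative_eq_intros)

lemma has_wirtinger_add:
  assumes "has_wirtinger f L M z" "has_wirtinger g L' M' z"
  shows "has_wirtinger (\<lambda>z. f z + g z) (\<lambda>v. L v + L' v) (\<lambda>v. M v + M' v) z"
  using assms unfolding has_wirtinger_def
  by (auto intro!: derivative_eq_intros simp: algebra_simps)

lemma has_wirtinger_diff:
  assumes "has_wirtinger f L M z" "has_wirtinger g L' M' z"
  shows "has_wirtinger (\<lambda>z. f z - g z) (\<lambda>v. L v - L' v) (\<lambda>v. M v - M' v) z"
  using assms unfolding has_wirtinger_def
  by (auto intro!: derivative_eq_intros simp: algebra_simps)

lemma has_wirtinger_mult:
  assumes "has_wirtinger f L M z" "has_wirtinger g L' M' z"
  shows "has_wirtinger (\<lambda>z. f z * g z)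
    (\<lambda>v. L v * g z + f z * L' v) (\<lambda>v. M v * g z + f z * M' v) z"
  using assms unfolding has_wirtinger_def
  by (auto intro!: derivative_eq_intros simp: algebra_simps)

lemma has_wirtinger_inverse:
  assumes "has_wirtinger f L M z" "f z \<noteq> 0"
  shows "has_wirtinger (\<lambda>z. inverse (f z))
    (\<lambda>v. - L v / (f z)\<^sup>2) (\<lambda>v. - M v / (f z)\<^sup>2) z"
  using assms unfolding has_wirtinger_def
  by (auto intro!: derivative_eq_intros simp: field_simps power2_eq_square)

text \<open>The differential of a real function is real, so its antilinear part is the conjugate of
  its linear part.\<close>

lemma has_wirtinger_of_real:
  assumes "(f has_derivative (\<lambda>v. 2 * Re (L v))) (at z)" "\<And>v. L (\<i> *s v) = \<i> * L v"
  shows "has_wirtinger (\<lambda>z. of_real (f z)) L (\<lambda>v. cnj (L v)) z"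
proof -
  have "((\<lambda>z. complex_of_real (f z)) has_derivative (\<lambda>v. of_real (2 * Re (L v)))) (at z)"
    by (rule has_derivative_of_real[OF assms(1)])
  then show ?thesis
    using assms(2) unfolding has_wirtinger_def by (simp add: complex_add_cnj)
qed

section \<open>Locality and degree\<close>

text \<open>\<open>frechet_derivative\<close> is a choice among all derivatives, so the two sides
  agree once \<open>f\<close> and \<open>g\<close> have the same derivatives; no differentiability
  is assumed.\<close>

lemma frechet_derivative_cong_open:
  assumes "open S" "z \<in> S" "\<And>w. w \<in> S \<Longrightarrow> f w = g w"
  shows "frechet_derivative f (at z) = frechet_derivative g (at z)"
proof -
  have "(f has_derivative f') (at z) \<longleftrightarrow> (g has_derivative f') (at z)" for f'
    using has_derivative_transform_within_open[of f f' z UNIV S g]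
      has_derivative_transform_within_open[of g f' z UNIV S f] assms by auto
  then show ?thesis unfolding frechet_derivative_def by simp
qed

lemma diff_lin_cong_open:
  assumes "open S" "z \<in> S" "\<And>w. w \<in> S \<Longrightarrow> f w = g w"
  shows "diff_lin f z = diff_lin g z"
  by (simp add: fun_eq_iff diff_lin_def frechet_derivative_cong_open[OF assms])

lemma diff_antilin_cong_open:
  assumes "open S" "z \<in> S" "\<And>w. w \<in> S \<Longrightarrow> f w = g w"
  shows "diff_antilin f z = diff_antilin g z"
  by (simp add: fun_eq_iff diff_antilin_def frechet_derivative_cong_open[OF assms])

lemma del_cong_open:
  assumes "open S" "z \<in> S" "\<And>w us. w \<in> S \<Longrightarrow> \<eta> w us = \<zeta> w us"
  shows "del \<eta> z vs = del \<zeta> z vs"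
proof -
  have "diff_lin (\<lambda>w. \<eta> w us) z = diff_lin (\<lambda>w. \<zeta> w us) z" for us
    using assms by (intro diff_lin_cong_open[of S]) auto
  then show ?thesis unfolding del_def by simp
qed

lemma delbar_cong_open:
  assumes "open S" "z \<in> S" "\<And>w us. w \<in> S \<Longrightarrow> \<eta> w us = \<zeta> w us"
  shows "delbar \<eta> z vs = delbar \<zeta> z vs"
proof -
  have "diff_antilin (\<lambda>w. \<eta> w us) z = diff_antilin (\<lambda>w. \<zeta> w us) z" for us
    using assms by (intro diff_antilin_cong_open[of S]) auto
  then show ?thesis unfolding delbar_def by simp
qed

definition pure_degree :: "nat \<Rightarrow> ('n::finite) form \<Rightarrow> bool" where
  "pure_degree k \<eta> \<longleftrightarrow> (\<forall>z vs. length vs \<noteq> k \<longrightarrow> \<eta> z vs = 0)"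

lemma pure_degree_form_of_fun: "pure_degree 0 (form_of_fun f)"
  by (simp add: pure_degree_def form_of_fun_def)

text \<open>Omitting one vector lowers the length by one, so in the wrong degree every function
  being differentiated is identically 0.\<close>

lemma pure_degree_del:
  assumes "pure_degree k \<eta>"
  shows "pure_degree (Suc k) (del \<eta>)"
  unfolding pure_degree_def
proof (intro allI impI)
  fix z and vs :: "(complex ^ 'a) list"
  assume len: "length vs \<noteq> Suc k"
  have "diff_lin (\<lambda>w. \<eta> w (take i vs @ drop (Suc i) vs)) z (vs ! i) = 0" if "i < length vs" for i
  proof -
    have "(\<lambda>w. \<eta> w (take i vs @ drop (Suc i) vs)) = (\<lambda>w. 0)"
      using assms that len by (auto simp: pure_degree_def)
    then show ?thesis by (simp add: diff_lin_eq[OF has_wirtinger_const])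
  qed
  then show "del \<eta> z vs = 0" by (simp add: del_def)
qed

lemma pure_degree_delbar:
  assumes "pure_degree k \<eta>"
  shows "pure_degree (Suc k) (delbar \<eta>)"
  unfolding pure_degree_def
proof (intro allI impI)
  fix z and vs :: "(complex ^ 'a) list"
  assume len: "length vs \<noteq> Suc k"
  have "diff_antilin (\<lambda>w. \<eta> w (take i vs @ drop (Suc i) vs)) z (vs ! i) = 0" if "i < length vs" for i
  proof -
    have "(\<lambda>w. \<eta> w (take i vs @ drop (Suc i) vs)) = (\<lambda>w. 0)"
      using assms that len by (auto simp: pure_degree_def)
    then show ?thesis by (simp add: diff_antilin_eq[OF has_wirtinger_const])
  qed
  then show "delbar \<eta> z vs = 0" by (simp add: delbar_def)
qed

section \<open>Implicitly defined real functions\<close>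

text \<open>Differentiability of \<open>F\<close> at a single point and continuity of
  \<open>g\<close> are enough: the linearisation error is first used to bound the increment of
  \<open>g\<close> linearly, then inserted again.\<close>

lemma implicit_has_derivative:
  fixes F :: "'a::real_normed_vector \<Rightarrow> real \<Rightarrow> real" and g :: "'a \<Rightarrow> real"
  assumes F: "((\<lambda>(z, t). F z t) has_derivative (\<lambda>(h, s). A h + B * s)) (at (z, g z))"
    and "B \<noteq> 0" and cont: "isCont g z"
    and ev: "\<forall>\<^sub>F w in nhds z. F w (g w) = c"
  shows "(g has_derivative (\<lambda>h. - A h / B)) (at z)"
  unfolding has_derivative_at_alt
proof (intro conjI allI impI)
  have bl: "bounded_linear (\<lambda>(h, s). A h + B * s)"
    using F by (rule has_derivative_bounded_linear)
  have "bounded_linear (\<lambda>h. (\<lambda>(h, s). A h + B * s) (h, 0))"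
    by (intro bounded_linear_compose[OF bl] bounded_linear_Pair bounded_linear_ident
        bounded_linear_zero)
  then have A: "bounded_linear A" by simp
  then show "bounded_linear (\<lambda>h. - A h / B)"
    by (intro bounded_linear_divide[THEN bounded_linear_compose] bounded_linear_minus)
  obtain K where K: "K > 0" "\<And>h. \<bar>A h\<bar> \<le> norm h * K"
    using bounded_linear.pos_bounded[OF A] by auto
  fix e :: real
  assume "e > 0"
  \<comment> \<open>With \<open>e' \<le> \<bar>B\<bar> / 2\<close> the error term in
    \<open>s\<close> is absorbed on the left, giving \<open>\<bar>s\<bar> \<le> M * norm h\<close>;
    the other bound on \<open>e'\<close> then makes the error at most
    \<open>e * \<bar>B\<bar> * norm h\<close>.\<close>
  define M where "M = 2 * K / \<bar>B\<bar> + 1"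
  define e' where "e' = min (\<bar>B\<bar> / 2) (e * \<bar>B\<bar> / (1 + M))"
  have M: "M > 0" using K \<open>B \<noteq> 0\<close> by (simp add: M_def add_pos_pos)
  have e': "e' > 0" "e' \<le> \<bar>B\<bar> / 2" "e' * (1 + M) \<le> e * \<bar>B\<bar>"
  proof -
    show "e' > 0" using \<open>e > 0\<close> \<open>B \<noteq> 0\<close> M by (simp add: e'_def)
    show "e' \<le> \<bar>B\<bar> / 2" unfolding e'_def by (rule min.cobounded1)
    have "e' \<le> e * \<bar>B\<bar> / (1 + M)" by (simp add: e'_def)
    then show "e' * (1 + M) \<le> e * \<bar>B\<bar>" using M by (simp add: pos_le_divide_eq)
  qed
  obtain d1 where d1: "d1 > 0" "\<And>w t. norm ((w, t) - (z, g z)) < d1 \<Longrightarrow>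
      \<bar>F w t - F z (g z) - (A (w - z) + B * (t - g z))\<bar> \<le> e' * norm ((w, t) - (z, g z))"
    using F e'(1) unfolding has_derivative_at_alt by force
  obtain d2 where d2: "d2 > 0" "\<And>w. norm (w - z) < d2 \<Longrightarrow> \<bar>g w - g z\<bar> < d1 / 2"
    using cont d1(1) unfolding continuous_at_eps_delta
    by (metis dist_norm half_gt_zero real_norm_def)
  obtain d3 where d3: "d3 > 0" "\<And>w. norm (w - z) < d3 \<Longrightarrow> F w (g w) = c"
    using ev unfolding eventually_nhds_metric by (auto simp: dist_norm)
  show "\<exists>d>0. \<forall>w. norm (w - z) < d \<longrightarrow>
      norm (g w - g z - - A (w - z) / B) \<le> e * norm (w - z)"
  proof (intro exI[of _ "min (d1 / 2) (min d2 d3)"] conjI allI impI)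
    show "min (d1 / 2) (min d2 d3) > 0" using d1 d2 d3 by simp
    fix w
    assume w: "norm (w - z) < min (d1 / 2) (min d2 d3)"
    define h s where "h = w - z" and "s = g w - g z"
    have "norm ((w, g w) - (z, g z)) \<le> norm h + \<bar>s\<bar>"
      using norm_Pair_le[of h s] by (simp add: h_def s_def)
    moreover have "norm h + \<bar>s\<bar> < d1"
      using w d2(2)[of w] by (simp add: h_def s_def)
    ultimately have "\<bar>F w (g w) - F z (g z) - (A h + B * s)\<bar> \<le> e' * (norm h + \<bar>s\<bar>)"
      using d1(2)[of w "g w"] e'(1) unfolding h_def s_def
      by (smt (verit) mult_left_mono)
    moreover have "F w (g w) = c" "F z (g z) = c" using w d3 by auto
    ultimately have 1: "\<bar>A h + B * s\<bar> \<le> e' * (norm h + \<bar>s\<bar>)" by linarith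
    have "e' * (norm h + \<bar>s\<bar>) \<le> \<bar>B\<bar> / 2 * (norm h + \<bar>s\<bar>)"
      using e' by (intro mult_right_mono) auto
    then have "\<bar>B\<bar> * \<bar>s\<bar> \<le> norm h * K + \<bar>B\<bar> / 2 * norm h + \<bar>B\<bar> / 2 * \<bar>s\<bar>"
      using 1 K(2)[of h] abs_mult[of B s] abs_triangle_ineq4[of "A h + B * s" "A h"]
      by (simp add: algebra_simps)
    then have "\<bar>s\<bar> \<le> M * norm h"
      using \<open>B \<noteq> 0\<close> by (simp add: M_def field_simps)
    then have "e' * (norm h + \<bar>s\<bar>) \<le> e' * ((1 + M) * norm h)"
      using e' by (intro mult_left_mono) (auto simp: algebra_simps)
    also have "\<dots> \<le> e * \<bar>B\<bar> * norm h"
      using mult_right_mono[OF e'(3), of "norm h"] by (simp add: mult.assoc)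
    finally have 2: "\<bar>A h + B * s\<bar> \<le> e * \<bar>B\<bar> * norm h" using 1 by linarith
    have "s - - A h / B = (A h + B * s) / B" using \<open>B \<noteq> 0\<close> by (simp add: field_simps)
    then have "\<bar>s - - A h / B\<bar> = \<bar>A h + B * s\<bar> / \<bar>B\<bar>" by (simp only: abs_divide)
    also have "\<dots> \<le> e * norm h" using 2 \<open>B \<noteq> 0\<close> by (simp add: field_simps)
    finally show "norm (g w - g z - - A (w - z) / B) \<le> e * norm (w - z)"
      by (simp add: h_def s_def)
  qed
qed

section \<open>Polynomial identities, with conjugate variables treated as independent\<close>

lemma dD_identity:
  fixes k l p q pb qb P Q D :: complex
  assumes "k + l = 1" "p * pb * P + q * qb * Q = 1" "D = k * (p * pb) * P + l * (q * qb) * Q"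
  shows "D * (k * v1 * pb * P + l * v2 * qb * Q) - (P * pb * v1 + Q * qb * v2) * (k^2 * (p * pb * P) + l^2 * (q * qb * Q))
   = (k - l) * pb * qb * P * Q * (l * q * v1 - k * p * v2)"
  using assms by algebra

text \<open>The left side is the derivative of \<partial>bar log \<Phi> with denominators cleared;
  its factorisation on the right is the rank-one property of \<partial>\<partial>bar log
  \<Phi>.\<close>

lemma ddbar_u_identity:
  fixes k l p q pb qb P Q D :: complex
  assumes "k + l = 1" "p * pb * P + q * qb * Q = 1" "D = k * (p * pb) * P + l * (q * qb) * Q"
  shows "D^2 * (P * v1 * w1 + Q * v2 * w2) - D * (P * pb * v1 + Q * qb * v2) * (k * P * p * w1 + l * Q * q * w2)
    - (k - l) * pb * qb * P * Q * (l * q * v1 - k * p * v2) * (P * p * w1 + Q * q * w2)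
   = P * Q * (l * q * v1 - k * p * v2) * (l * qb * w1 - k * pb * w2)"
  using assms by algebra

section \<open>The potential\<close>

locale class_1_hopf =
  fixes \<alpha> \<beta> :: complex
  assumes \<alpha>: "1 < cmod \<alpha>" and \<beta>: "1 < cmod \<beta>"
begin

abbreviation k\<^sub>1 :: real where "k\<^sub>1 \<equiv> hopf_k1 \<alpha> \<beta>"
abbreviation k\<^sub>2 :: real where "k\<^sub>2 \<equiv> hopf_k2 \<alpha> \<beta>"
abbreviation \<Phi> :: "complex ^ 2 \<Rightarrow> real" where "\<Phi> \<equiv> hopf_phi \<alpha> \<beta>"

definition F :: "complex ^ 2 \<Rightarrow> real \<Rightarrow> real" where
  "F z t = (cmod (z $ 1))\<^sup>2 * t powr (- 2 * k\<^sub>1) + (cmod (z $ 2))\<^sup>2 * t powr (- 2 * k\<^sub>2)"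

definition P :: "complex ^ 2 \<Rightarrow> real" where "P z = \<Phi> z powr (- 2 * k\<^sub>1)"
definition Q :: "complex ^ 2 \<Rightarrow> real" where "Q z = \<Phi> z powr (- 2 * k\<^sub>2)"

text \<open>The derivative of \<open>F z\<close> at \<open>\<Phi> z\<close> is
  \<open>- 2 * D z / \<Phi> z\<close>.\<close>

definition D :: "complex ^ 2 \<Rightarrow> real" where
  "D z = k\<^sub>1 * (cmod (z $ 1))\<^sup>2 * P z + k\<^sub>2 * (cmod (z $ 2))\<^sup>2 * Q z"

lemma ln_pos: "ln (cmod \<alpha>) > 0" "ln (cmod \<beta>) > 0"
  using \<alpha> \<beta> by (auto intro: ln_gt_zero)

lemma k_pos: "k\<^sub>1 > 0" "k\<^sub>2 > 0"
  using ln_pos by (simp_all add: hopf_k1_def hopf_k2_def)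

lemma k_sum: "k\<^sub>1 + k\<^sub>2 = 1"
  using ln_pos by (simp add: hopf_k1_def hopf_k2_def flip: add_divide_distrib)

lemma F_phi:
  assumes "z \<noteq> 0"
  shows phi_pos: "\<Phi> z > 0" and F_phi_eq: "F z (\<Phi> z) = 1"
  using theI'[OF hopf_phi_ex1[OF \<alpha> \<beta> assms]] by (auto simp: hopf_phi_def F_def)

lemma phi_eqI:
  assumes "z \<noteq> 0" "t > 0" "F z t = 1"
  shows "\<Phi> z = t"
  using the1_equality[OF hopf_phi_ex1[OF \<alpha> \<beta> assms(1)]] assms(2,3)
  by (auto simp: hopf_phi_def F_def)

lemma PQ_pos:
  assumes "z \<noteq> 0"
  shows "P z > 0" "Q z > 0"
  using phi_pos[OF assms] by (simp_all add: P_def Q_def)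

lemma PQ_sum: "z \<noteq> 0 \<Longrightarrow> (cmod (z $ 1))\<^sup>2 * P z + (cmod (z $ 2))\<^sup>2 * Q z = 1"
  using F_phi_eq by (simp add: F_def P_def Q_def)

text \<open>By \<open>PQ_sum\<close>, \<open>D z\<close> is a convex combination of
  \<open>k\<^sub>1\<close> and \<open>k\<^sub>2\<close>.\<close>

lemma D_pos:
  assumes "z \<noteq> 0"
  shows "D z > 0"
proof -
  have nn: "(cmod (z $ 1))\<^sup>2 * P z \<ge> 0" "(cmod (z $ 2))\<^sup>2 * Q z \<ge> 0"
    using PQ_pos[OF assms] by simp_all
  have "min k\<^sub>1 k\<^sub>2 * 1 \<le> D z"
    unfolding PQ_sum[OF assms, symmetric] D_def distrib_left mult.assoc
    using nn by (intro add_mono mult_right_mono) auto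
  then show ?thesis using k_pos by linarith
qed

lemma F_strict_antimono:
  assumes "z \<noteq> 0" "0 < s" "s < t"
  shows "F z t < F z s"
proof -
  have less: "t powr (- 2 * k\<^sub>1) < s powr (- 2 * k\<^sub>1)" "t powr (- 2 * k\<^sub>2) < s powr (- 2 * k\<^sub>2)"
    using assms k_pos by (auto intro!: powr_less_mono2_neg)
  have "z $ 1 \<noteq> 0 \<or> z $ 2 \<noteq> 0" using assms(1) by (simp add: vec2_eq_iff)
  then show ?thesis
  proof
    assume "z $ 1 \<noteq> 0"
    then show ?thesis unfolding F_def
      using less by (intro add_less_le_mono mult_strict_left_mono mult_left_mono) auto
  next
    assume "z $ 2 \<noteq> 0"
    then show ?thesis unfolding F_def
      using less by (intro add_le_less_mono mult_strict_left_mono mult_left_mono) auto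
  qed
qed

lemma isCont_F: "t > 0 \<Longrightarrow> isCont (\<lambda>z. F z t) z"
  unfolding F_def by (intro continuous_intros)

text \<open>As \<open>F z\<close> is strictly decreasing, comparing \<open>\<Phi> z\<close> with a
  fixed t > 0 amounts to comparing \<open>F z t\<close> with 1, which is an open condition on
  \<open>z\<close>.\<close>

lemma isCont_phi:
  assumes "z \<noteq> 0"
  shows "isCont \<Phi> z"
  unfolding isCont_def
proof (rule order_tendstoI)
  have nz: "\<forall>\<^sub>F w in at z. w \<noteq> 0"
    by (rule eventually_neq_at_within)
  have lim: "((\<lambda>w. F w t) \<longlongrightarrow> F z t) (at z)" if "t > 0" for t
    using isCont_F[OF that] by (simp add: isCont_def)
  fix t
  show "\<forall>\<^sub>F w in at z. t < \<Phi> w" if "t < \<Phi> z"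
  proof (cases "t > 0")
    case True
    have "1 < F z t"
      using F_strict_antimono[OF assms True that] F_phi_eq[OF assms] by simp
    from order_tendstoD(1)[OF lim[OF True] this] nz show ?thesis
    proof eventually_elim
      case (elim w)
      then show ?case
        using F_strict_antimono[of w "\<Phi> w" t] phi_pos[of w] F_phi_eq[of w]
        by (metis less_asym not_less_iff_gr_or_eq)
    qed
  next
    case False
    show ?thesis
      using nz by eventually_elim (use False phi_pos in force)
  qed
  show "\<forall>\<^sub>F w in at z. \<Phi> w < t" if "\<Phi> z < t"
  proof -
    have t: "t > 0" using that phi_pos[OF assms] by simp
    have "F z t < 1"
      using F_strict_antimono[OF assms phi_pos[OF assms] that] F_phi_eq[OF assms] by simp
    from order_tendstoD(2)[OF lim[OF t] this] nz show ?thesis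
    proof eventually_elim
      case (elim w)
      then show ?case
        using F_strict_antimono[of w t "\<Phi> w"] t F_phi_eq[of w]
        by (metis less_asym not_less_iff_gr_or_eq)
    qed
  qed
qed

text \<open>The 1-form \<open>\<partial> log \<Phi>\<close>, found by differentiating \<open>F z (\<Phi> z) = 1\<close>.\<close>

definition du :: "complex ^ 2 \<Rightarrow> complex ^ 2 \<Rightarrow> complex" where
  "du z v = (P z * cnj (z $ 1) * v $ 1 + Q z * cnj (z $ 2) * v $ 2) / (2 * D z)"

lemma du_mult_i: "du z (\<i> *s v) = \<i> * du z v"
  by (simp add: du_def algebra_simps add_divide_distrib)

lemma phi_has_derivative:
  assumes z: "z \<noteq> 0"
  shows "(\<Phi> has_derivative (\<lambda>v. 2 * Re (\<Phi> z * du z v))) (at z)"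
proof -
  \<comment> \<open>\<open>A\<close> and \<open>B\<close> are the partial differentials of
    \<open>F\<close> in \<open>z\<close> and in \<open>t\<close> at
    \<open>(z, \<Phi> z)\<close>.\<close>
  define A where "A = (\<lambda>v :: complex ^ 2. 2 * P z * (z $ 1 \<bullet> v $ 1) + 2 * Q z * (z $ 2 \<bullet> v $ 2))"
  define B where "B = - 2 * D z / \<Phi> z"
  have "((\<lambda>(w, t). F w t) has_derivative (\<lambda>(v, s). A v + B * s)) (at (z, \<Phi> z))"
    using phi_pos[OF z]
    unfolding F_def split_beta' power2_norm_eq_inner
    by (auto intro!: derivative_eq_intros bounded_linear_imp_has_derivative bounded_linear_vec_nth
        bounded_linear_compose[OF bounded_linear_vec_nth bounded_linear_fst]
        simp: A_def B_def D_def P_def Q_def power2_norm_eq_inner inner_commute field_simps fun_eq_iff)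
  moreover have "B \<noteq> 0" using D_pos[OF z] phi_pos[OF z] by (simp add: B_def)
  moreover have "\<forall>\<^sub>F w in nhds z. F w (\<Phi> w) = 1"
    using t1_space_nhds[OF z] by (rule eventually_mono) (simp add: F_phi_eq)
  ultimately have "(\<Phi> has_derivative (\<lambda>v. - A v / B)) (at z)"
    using isCont_phi[OF z] by (intro implicit_has_derivative)
  moreover have "- A v / B = 2 * Re (\<Phi> z * du z v)" for v
    using D_pos[OF z] phi_pos[OF z]
    by (simp add: A_def B_def du_def inner_complex_def field_simps)
  ultimately show ?thesis by simp
qed

section \<open>Derivatives of the coefficients\<close>

abbreviation Dc :: "complex ^ 2 \<Rightarrow> complex" where "Dc z \<equiv> of_real (D z)"

text \<open>The form \<sigma>; it annihilates the vector field with components k1 z1 and k2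
  z2.\<close>

definition sg :: "complex ^ 2 \<Rightarrow> complex ^ 2 \<Rightarrow> complex" where
  "sg z v = k\<^sub>2 * z $ 2 * v $ 1 - k\<^sub>1 * z $ 1 * v $ 2"

text \<open>This is \<partial>D. It is a multiple of \<open>sg\<close> because \<open>D\<close> is
  invariant under the flow of the field that \<open>sg\<close> annihilates.\<close>

definition dD :: "complex ^ 2 \<Rightarrow> complex ^ 2 \<Rightarrow> complex" where
  "dD z v = (k\<^sub>1 - k\<^sub>2) * P z * Q z * cnj (z $ 1) * cnj (z $ 2) * sg z v / D z"

text \<open>The coefficient in \<open>\<partial>\<partial>bar log \<Phi> = c \<sigma> \<and> cnj \<sigma>\<close>.\<close>

definition c :: "complex ^ 2 \<Rightarrow> complex" where
  "c z = P z * Q z / (2 * D z ^ 3)"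

lemma cnj_c [simp]: "cnj (c z) = c z"
  by (simp add: c_def)

lemma D_complex:
  "Dc z = k\<^sub>1 * (z $ 1 * cnj (z $ 1)) * P z + k\<^sub>2 * (z $ 2 * cnj (z $ 2)) * Q z"
  unfolding complex_norm_square[symmetric] by (simp add: D_def)

lemma PQ_sum_complex:
  assumes "z \<noteq> 0"
  shows "z $ 1 * cnj (z $ 1) * P z + z $ 2 * cnj (z $ 2) * Q z = 1"
  unfolding complex_norm_square[symmetric] of_real_mult[symmetric] of_real_add[symmetric]
    PQ_sum[OF assms] by simp

lemma k_sum_complex: "complex_of_real k\<^sub>1 + complex_of_real k\<^sub>2 = 1"
  by (simp add: k_sum flip: of_real_add)

lemma has_wirtinger_phi:
  "z \<noteq> 0 \<Longrightarrow> has_wirtinger (\<lambda>z. of_real (\<Phi> z)) (\<lambda>v. \<Phi> z * du z v) (\<lambda>v. \<Phi> z * cnj (du z v)) z"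
  using has_wirtinger_of_real[OF phi_has_derivative] by (simp add: du_mult_i)

lemma has_wirtinger_phi_powr:
  assumes "z \<noteq> 0"
  shows "has_wirtinger (\<lambda>z. of_real (\<Phi> z powr m))
    (\<lambda>v. m * \<Phi> z powr m * du z v) (\<lambda>v. m * \<Phi> z powr m * cnj (du z v)) z"
proof -
  have "((\<lambda>z. \<Phi> z powr m) has_derivative
      (\<lambda>v. 2 * Re (of_real (m * \<Phi> z powr m) * du z v))) (at z)"
    using phi_pos[OF assms]
    by (auto intro!: derivative_eq_intros phi_has_derivative[OF assms])
  from has_wirtinger_of_real[OF this] show ?thesis by (simp add: du_mult_i)
qed

lemmas has_wirtinger_P = has_wirtinger_phi_powr[of _ "- 2 * k\<^sub>1", folded P_def]
lemmas has_wirtinger_Q = has_wirtinger_phi_powr[of _ "- 2 * k\<^sub>2", folded Q_def]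

lemmas has_wirtinger_intros = has_wirtinger_const has_wirtinger_nth has_wirtinger_cnj
  has_wirtinger_add has_wirtinger_diff has_wirtinger_mult has_wirtinger_inverse
  has_wirtinger_phi has_wirtinger_P has_wirtinger_Q

lemma Dc_nonzero: "z \<noteq> 0 \<Longrightarrow> Dc z \<noteq> 0"
  using D_pos by force

text \<open>Such denominator-free forms reduce later claims to polynomial identities.\<close>

lemma du_times: "z \<noteq> 0 \<Longrightarrow> 2 * Dc z * du z v = P z * cnj (z $ 1) * v $ 1 + Q z * cnj (z $ 2) * v $ 2"
  using Dc_nonzero by (simp add: du_def)

lemma dD_times:
  "z \<noteq> 0 \<Longrightarrow> Dc z * dD z v = (k\<^sub>1 - k\<^sub>2) * cnj (z $ 1) * cnj (z $ 2) * P z * Q z * sg z v"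
  using Dc_nonzero by (simp add: dD_def)

lemma c_times: "z \<noteq> 0 \<Longrightarrow> 2 * Dc z ^ 3 * c z = P z * Q z"
  using Dc_nonzero by (simp add: c_def)

lemma has_wirtinger_D:
  assumes z: "z \<noteq> 0"
  shows "has_wirtinger Dc (dD z) (\<lambda>v. cnj (dD z v)) z"
proof -
  \<comment> \<open>The left side is what the product rule gives for \<partial>D, using \<partial>P
    = -2 k1 P \<partial>log \<Phi> and its analogue for \<open>Q\<close>.\<close>
  have *: "k\<^sub>1 * v $ 1 * cnj (z $ 1) * P z + k\<^sub>2 * v $ 2 * cnj (z $ 2) * Q z
      - 2 * du z v * (k\<^sub>1\<^sup>2 * (z $ 1 * cnj (z $ 1) * P z) + k\<^sub>2\<^sup>2 * (z $ 2 * cnj (z $ 2) * Q z)) = dD z v"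
    (is "?l = _") for v
  proof -
    have "Dc z * ?l = Dc z * (k\<^sub>1 * v $ 1 * cnj (z $ 1) * P z + k\<^sub>2 * v $ 2 * cnj (z $ 2) * Q z)
      - (2 * Dc z * du z v) * (k\<^sub>1\<^sup>2 * (z $ 1 * cnj (z $ 1) * P z) + k\<^sub>2\<^sup>2 * (z $ 2 * cnj (z $ 2) * Q z))"
      by (simp add: algebra_simps)
    also have "\<dots> = Dc z * dD z v"
      unfolding du_times[OF z] dD_times[OF z] sg_def of_real_diff of_real_power
      by (rule dD_identity[OF k_sum_complex PQ_sum_complex[OF z] D_complex])
    finally have "Dc z * ?l = Dc z * dD z v" .
    then show ?thesis using Dc_nonzero[OF z] by simp
  qed
  show ?thesis
    unfolding D_complex
    apply (rule has_wirtinger_cong)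
      apply (rule has_wirtinger_intros z)+
    subgoal for v using *[of v] by (simp add: algebra_simps power2_eq_square)
    subgoal for v using arg_cong[OF *[of v], of cnj] by (simp add: algebra_simps power2_eq_square)
    done
qed

text \<open>The wedge of \<open>du\<close> and \<open>sg\<close> is a constant multiple of dz1
  \<and> dz2: the determinant of their coefficients is -D / (2 D) by
  \<open>D_complex\<close>.\<close>

lemma du_sg_commute:
  assumes z: "z \<noteq> 0"
  shows "2 * (du z y * sg z v - du z v * sg z y) = y $ 2 * v $ 1 - y $ 1 * v $ 2"
proof -
  have "Dc z * (2 * (du z y * sg z v - du z v * sg z y)) =
      (2 * Dc z * du z y) * sg z v - (2 * Dc z * du z v) * sg z y"
    by (simp add: algebra_simps)
  also have "\<dots> = Dc z * (y $ 2 * v $ 1 - y $ 1 * v $ 2)"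
    unfolding du_times[OF z] sg_def unfolding D_complex by (simp add: algebra_simps)
  finally show ?thesis using Dc_nonzero[OF z] by simp
qed

text \<open>\<open>S z x w\<close> is the antilinear derivative of \<open>cnj (du z w)\<close> in direction \<open>x\<close>; its symmetry
  expresses \<open>\<partial>bar \<partial>bar log \<Phi> = 0\<close>.\<close>

definition S :: "complex ^ 2 \<Rightarrow> complex ^ 2 \<Rightarrow> complex ^ 2 \<Rightarrow> complex" where
  "S z x w = - 1 / Dc z * ((k\<^sub>1 * P z * z $ 1 * cnj (w $ 1) + k\<^sub>2 * Q z * z $ 2 * cnj (w $ 2)) * cnj (du z x)
     + cnj (du z w) * cnj (dD z x))"

text \<open>Since \<open>dD\<close> is a multiple of \<open>sg\<close>, \<open>du_sg_commute\<close>
  evaluates the antisymmetrised \<open>du\<close>-\<open>dD\<close> term, which cancels the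
  antisymmetrised weighted term.\<close>

lemma S_sym:
  assumes z: "z \<noteq> 0"
  shows "S z x w = S z w x"
proof -
  have *: "(k\<^sub>1 * P z * cnj (z $ 1) * w $ 1 + k\<^sub>2 * Q z * cnj (z $ 2) * w $ 2) * du z x + du z w * dD z x
    = (k\<^sub>1 * P z * cnj (z $ 1) * x $ 1 + k\<^sub>2 * Q z * cnj (z $ 2) * x $ 2) * du z w + du z x * dD z w"
    (is "?l = ?r")
  proof -
    define f where "f = (k\<^sub>1 - k\<^sub>2) * P z * Q z * cnj (z $ 1) * cnj (z $ 2)"
    have f: "Dc z * dD z v = f * sg z v" for v
      by (simp add: dD_times[OF z] f_def)
    have "2 * Dc z * (?l - ?r) =
        (k\<^sub>1 * P z * cnj (z $ 1) * w $ 1 + k\<^sub>2 * Q z * cnj (z $ 2) * w $ 2) * (2 * Dc z * du z x)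
        - (k\<^sub>1 * P z * cnj (z $ 1) * x $ 1 + k\<^sub>2 * Q z * cnj (z $ 2) * x $ 2) * (2 * Dc z * du z w)
        + 2 * (du z w * (Dc z * dD z x) - du z x * (Dc z * dD z w))"
      by (simp add: algebra_simps)
    also have "2 * (du z w * (Dc z * dD z x) - du z x * (Dc z * dD z w)) = f * (w $ 2 * x $ 1 - w $ 1 * x $ 2)"
      unfolding f du_sg_commute[OF z, symmetric] by (simp add: algebra_simps)
    finally have "2 * Dc z * (?l - ?r) = 0"
      unfolding du_times[OF z] f_def by (simp add: algebra_simps)
    then show ?thesis using Dc_nonzero[OF z] by simp
  qed
  show ?thesis
    unfolding S_def using arg_cong[OF *, of cnj] by simp
qed

text \<open>The linear part is \<partial>\<partial>bar log \<Phi>, here shown to be c \<sigma>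
  \<and> cnj \<sigma>.\<close>

lemma has_wirtinger_cnj_du:
  assumes z: "z \<noteq> 0"
  shows "has_wirtinger (\<lambda>z. cnj (du z w)) (\<lambda>v. c z * sg z v * cnj (sg z w)) (\<lambda>x. S z x w) z"
proof -
  have eq: "cnj (du z w) = (P z * z $ 1 * cnj (w $ 1) + Q z * z $ 2 * cnj (w $ 2)) * inverse (2 * Dc z)" for z
    by (simp add: du_def field_simps)
  have *: "(P z * (v $ 1 - 2 * k\<^sub>1 * du z v * z $ 1) * cnj (w $ 1)
      + Q z * (v $ 2 - 2 * k\<^sub>2 * du z v * z $ 2) * cnj (w $ 2)) / (2 * Dc z)
      - cnj (du z w) * dD z v / Dc z = c z * sg z v * cnj (sg z w)" (is "?l = ?r") for v
  proof -
    have du_cnj: "cnj (2 * Dc z * du z w) = P z * z $ 1 * cnj (w $ 1) + Q z * z $ 2 * cnj (w $ 2)"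
      by (simp only: du_times[OF z]) simp
    \<comment> \<open>The factor \<open>2 * Dc z ^ 3\<close> clears the denominators of
      \<open>du\<close>, \<open>dD\<close> and \<open>c\<close>, which yields the left side of
      \<open>ddbar_u_identity\<close>.\<close>
    have "2 * Dc z ^ 3 * ?l = (Dc z)\<^sup>2 * (P z * v $ 1 * cnj (w $ 1) + Q z * v $ 2 * cnj (w $ 2))
        - Dc z * (2 * Dc z * du z v) * (k\<^sub>1 * P z * z $ 1 * cnj (w $ 1) + k\<^sub>2 * Q z * z $ 2 * cnj (w $ 2))
        - (Dc z * dD z v) * cnj (2 * Dc z * du z w)"
      using Dc_nonzero[OF z] by (simp add: field_simps power2_eq_square power3_eq_cube)
    also have "\<dots> = P z * Q z * sg z v * cnj (sg z w)"
      using ddbar_u_identity[OF k_sum_complex PQ_sum_complex[OF z] D_complex,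
          of "v $ 1" "cnj (w $ 1)" "v $ 2" "cnj (w $ 2)"]
      unfolding du_times[OF z, of v] dD_times[OF z] du_cnj by (simp add: sg_def)
    also have "\<dots> = 2 * Dc z ^ 3 * ?r"
      unfolding c_times[OF z, symmetric] by (simp only: mult_ac)
    finally show ?thesis using Dc_nonzero[OF z] by simp
  qed
  show ?thesis
    unfolding eq
    apply (rule has_wirtinger_cong)
      apply (rule has_wirtinger_intros has_wirtinger_D z)+
    using Dc_nonzero[OF z] apply simp
    subgoal for v
      using *[of v] Dc_nonzero[OF z] unfolding eq by (simp add: field_simps power2_eq_square)
    subgoal for v
      using Dc_nonzero[OF z] unfolding S_def eq
      apply (simp add: field_simps power2_eq_square)
      done
    done
qed

lemma has_wirtinger_du:
  assumes "z \<noteq> 0"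
  shows "has_wirtinger (\<lambda>z. du z w) (\<lambda>v. cnj (S z v w)) (\<lambda>x. c z * cnj (sg z x) * sg z w) z"
  using has_wirtinger_cnj[OF has_wirtinger_cnj_du[OF assms], of w] by simp

text \<open>Logarithmic differentiation: \<open>P\<close> and \<open>Q\<close> contribute -2 (k1 +
  k2) = -2 times \<open>du\<close>, and the cube of \<open>D\<close> contributes -3
  \<open>dD\<close> / \<open>D\<close>.\<close>

lemma has_wirtinger_c:
  assumes z: "z \<noteq> 0"
  shows "has_wirtinger c (\<lambda>v. - c z * (2 * du z v + 3 * dD z v / D z))
    (\<lambda>v. - c z * cnj (2 * du z v + 3 * dD z v / D z)) z"
proof -
  have eq: "c = (\<lambda>z. of_real (P z) * of_real (Q z) * (1 / 2) * (inverse (Dc z) * inverse (Dc z) * inverse (Dc z)))"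
    by (simp add: c_def fun_eq_iff field_simps power3_eq_cube)
  have k\<^sub>2: "of_real k\<^sub>2 = 1 - complex_of_real k\<^sub>1" using k_sum_complex by (simp add: algebra_simps)
  show ?thesis
    unfolding eq
    apply (rule has_wirtinger_cong)
      apply (rule has_wirtinger_intros has_wirtinger_D z Dc_nonzero)+
    subgoal using Dc_nonzero[OF z] by (simp add: k\<^sub>2 field_simps power2_eq_square)
    subgoal using Dc_nonzero[OF z] by (simp add: k\<^sub>2 field_simps power2_eq_square)
    done
qed

text \<open>\<open>K z y v w\<close> is the linear derivative of \<open>c z * sg z v * cnj (sg z w)\<close> in direction \<open>y\<close>; its
  symmetry in \<open>y\<close> and \<open>v\<close> expresses \<open>\<partial> (\<partial>\<partial>bar log \<Phi>) = 0\<close>.\<close>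

definition K :: "complex ^ 2 \<Rightarrow> complex ^ 2 \<Rightarrow> complex ^ 2 \<Rightarrow> complex ^ 2 \<Rightarrow> complex" where
  "K z y v w = c z * cnj (sg z w) * (sg y v - (2 * du z y + 3 * dD z y / D z) * sg z v)"

text \<open>The exterior derivative of \<sigma> cancels against 2 \<partial>log \<Phi> \<and>
  \<sigma> by \<open>du_sg_commute\<close>, and \<partial>D \<and> \<sigma> = 0 by
  proportionality.\<close>

lemma K_sym:
  assumes z: "z \<noteq> 0"
  shows "K z y v w = K z v y w"
proof -
  have "sg y v - sg v y = (of_real k\<^sub>1 + of_real k\<^sub>2) * (y $ 2 * v $ 1 - y $ 1 * v $ 2)"
    by (simp add: sg_def algebra_simps)
  then have "sg y v - 2 * du z y * sg z v = sg v y - 2 * du z v * sg z y"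
    using du_sg_commute[OF z, of y v] k_sum_complex by algebra
  moreover have "dD z y * sg z v = dD z v * sg z y"
    by (simp add: dD_def)
  moreover have "K z y v w = c z * cnj (sg z w) *
      ((sg y v - 2 * du z y * sg z v) - 3 * (dD z y * sg z v) / D z)" for y v
    by (simp add: K_def algebra_simps)
  ultimately show ?thesis
    by presburger
qed

lemma has_wirtinger_sg: "has_wirtinger (\<lambda>z. sg z v) (\<lambda>y. sg y v) (\<lambda>y. 0) z"
  unfolding sg_def
  apply (rule has_wirtinger_cong)
    apply (rule has_wirtinger_intros)+
  by simp_all

lemma has_wirtinger_ddbar_u:
  assumes z: "z \<noteq> 0"
  shows "has_wirtinger (\<lambda>z. c z * sg z v * cnj (sg z w))
    (\<lambda>y. K z y v w) (\<lambda>x. cnj (K z x w v)) z"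
  apply (rule has_wirtinger_cong)
    apply (rule has_wirtinger_intros has_wirtinger_sg has_wirtinger_c z)+
  by (simp_all add: K_def algebra_simps)


section \<open>The Gauduchon condition on the covering\<close>

text \<open>The Hermitian form whose antisymmetrisation is \<partial>\<partial>bar \<Phi> / \<Phi> =
  \<partial>\<partial>bar u + \<partial>u \<and> \<partial>bar u.\<close>

definition H :: "complex ^ 2 \<Rightarrow> complex ^ 2 \<Rightarrow> complex ^ 2 \<Rightarrow> complex" where
  "H z v w = c z * sg z v * cnj (sg z w) + du z v * cnj (du z w)"

lemma has_wirtinger_H:
  assumes z: "z \<noteq> 0"
  shows "has_wirtinger (\<lambda>z. H z v w)
    (\<lambda>y. K z y v w + cnj (S z y v) * cnj (du z w) + du z v * (c z * sg z y * cnj (sg z w)))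
    (\<lambda>x. cnj (K z x w v) + c z * cnj (sg z x) * sg z v * cnj (du z w) + du z v * S z x w) z"
  unfolding H_def
  apply (rule has_wirtinger_cong)
    apply (rule has_wirtinger_add has_wirtinger_mult[OF has_wirtinger_du has_wirtinger_cnj_du]
      has_wirtinger_ddbar_u z)+
  by (simp_all add: algebra_simps)

definition \<Omega> :: "2 form" where
  "\<Omega> z vs = (if length vs = 2 then \<i> * (H z (vs ! 0) (vs ! 1) - H z (vs ! 1) (vs ! 0)) else 0)"

lemma pure_degree_\<Omega>: "pure_degree 2 \<Omega>"
  by (simp add: pure_degree_def \<Omega>_def)

lemma delbar_phi:
  assumes "z \<noteq> 0"
  shows "delbar (form_of_fun (\<lambda>w. of_real (\<Phi> w))) z [v] = \<Phi> z * cnj (du z v)"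
  using diff_antilin_eq[OF has_wirtinger_phi[OF assms]]
  by (simp add: delbar_def form_of_fun_def)

lemma hopf_cover_form_eq:
  assumes z: "z \<noteq> 0"
  shows "hopf_cover_form \<alpha> \<beta> z vs = \<Omega> z vs"
proof (cases "length vs = 2")
  case False
  have "pure_degree (Suc (Suc 0)) (del (delbar (form_of_fun (\<lambda>w. complex_of_real (\<Phi> w)))))"
    by (intro pure_degree_del pure_degree_delbar pure_degree_form_of_fun)
  then show ?thesis
    using False by (simp add: hopf_cover_form_def \<Omega>_def pure_degree_def numeral_2_eq_2)
next
  case True
  then obtain a b where vs: "vs = [a, b]"
    by (auto simp: numeral_2_eq_2 length_Suc_conv)
  have lin: "diff_lin (\<lambda>w. delbar (form_of_fun (\<lambda>w. of_real (\<Phi> w))) w [b]) z a = \<Phi> z * H z a b"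
    for a b
  proof -
    have "has_wirtinger (\<lambda>z. \<Phi> z * cnj (du z b)) (\<lambda>v. \<Phi> z * H z v b)
        (\<lambda>v. \<Phi> z * cnj (du z v) * cnj (du z b) + \<Phi> z * S z v b) z"
      by (rule has_wirtinger_cong[OF has_wirtinger_mult[OF has_wirtinger_phi has_wirtinger_cnj_du]])
        (simp_all add: z H_def algebra_simps)
    moreover have "diff_lin (\<lambda>w. delbar (form_of_fun (\<lambda>w. of_real (\<Phi> w))) w [b]) z =
        diff_lin (\<lambda>z. \<Phi> z * cnj (du z b)) z"
      \<comment> \<open>The formula \<open>delbar_phi\<close> holds off the origin only, which is an
        open set around \<open>z\<close>.\<close>
      using z by (intro diff_lin_cong_open[of "- {0}"]) (auto simp: delbar_phi)
    ultimately show ?thesis by (simp add: diff_lin_eq)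
  qed
  show ?thesis
    using phi_pos[OF z]
    by (simp add: hopf_cover_form_def \<Omega>_def vs del_def lin numeral_2_eq_2 lessThan_Suc field_simps)
qed

text \<open>Its antisymmetrisation is \<partial>\<partial>bar u \<and> \<partial>bar u, which up to
  sign is what \<partial>bar leaves of the metric form.\<close>

definition T :: "complex ^ 2 \<Rightarrow> complex ^ 2 \<Rightarrow> complex ^ 2 \<Rightarrow> complex ^ 2 \<Rightarrow> complex" where
  "T z v x w = c z * sg z v * cnj (sg z x) * cnj (du z w)"

lemma has_wirtinger_T:
  assumes z: "z \<noteq> 0"
  shows "has_wirtinger (\<lambda>z. T z v x w)
    (\<lambda>y. K z y v x * cnj (du z w) + c z * sg z v * cnj (sg z x) * (c z * sg z y * cnj (sg z w)))
    (\<lambda>y. cnj (K z y x v) * cnj (du z w) + c z * sg z v * cnj (sg z x) * S z y w) z"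
  unfolding T_def
  by (rule has_wirtinger_mult[OF has_wirtinger_ddbar_u has_wirtinger_cnj_du]; fact z)

lemma delbar_\<Omega>:
  assumes z: "z \<noteq> 0"
  shows "delbar \<Omega> z [v\<^sub>0, v\<^sub>1, v\<^sub>2] = \<i> *
    (T z v\<^sub>1 v\<^sub>0 v\<^sub>2 - T z v\<^sub>2 v\<^sub>0 v\<^sub>1 - T z v\<^sub>0 v\<^sub>1 v\<^sub>2 + T z v\<^sub>2 v\<^sub>1 v\<^sub>0 + T z v\<^sub>0 v\<^sub>2 v\<^sub>1 - T z v\<^sub>1 v\<^sub>2 v\<^sub>0)"
proof -
  let ?M = "\<lambda>x v w. cnj (K z x w v) + c z * cnj (sg z x) * sg z v * cnj (du z w) + du z v * S z x w"
  have *: "diff_antilin (\<lambda>w. \<Omega> w [a, b]) z x = \<i> * (?M x a b - ?M x b a)" for x a b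
    using diff_antilin_eq[OF has_wirtinger_mult[OF has_wirtinger_const
        has_wirtinger_diff[OF has_wirtinger_H[OF z] has_wirtinger_H[OF z]]], of \<i> a b b a x]
    by (simp add: \<Omega>_def)
  show ?thesis
    \<comment> \<open>The \<open>K\<close> and \<open>S\<close> terms cancel in pairs, by closedness
      of \<partial>\<partial>bar u and \<partial>bar u; only six terms in \<open>T\<close>
      survive.\<close>
    using K_sym[OF z, of v\<^sub>1 v\<^sub>0] K_sym[OF z, of v\<^sub>2 v\<^sub>0] K_sym[OF z, of v\<^sub>2 v\<^sub>1]
      S_sym[OF z, of v\<^sub>1 v\<^sub>0] S_sym[OF z, of v\<^sub>2 v\<^sub>0] S_sym[OF z, of v\<^sub>2 v\<^sub>1]
    by (simp add: delbar_def * T_def numeral_2_eq_2 lessThan_Suc algebra_simps)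
qed

lemma del_delbar_\<Omega>:
  assumes z: "z \<noteq> 0"
  shows "del (delbar \<Omega>) z vs = 0"
proof (cases "length vs = 4")
  case False
  have "pure_degree (Suc (Suc 2)) (del (delbar \<Omega>))"
    by (intro pure_degree_del pure_degree_delbar pure_degree_\<Omega>)
  then show ?thesis
    using False by (simp add: pure_degree_def)
next
  case True
  then obtain v\<^sub>0 v\<^sub>1 v\<^sub>2 v\<^sub>3 where vs: "vs = [v\<^sub>0, v\<^sub>1, v\<^sub>2, v\<^sub>3]"
    by (auto simp: numeral_eq_Suc length_Suc_conv)
  let ?L = "\<lambda>y v x w. K z y v x * cnj (du z w) + c z * sg z v * cnj (sg z x) * (c z * sg z y * cnj (sg z w))"
  have *: "diff_lin (\<lambda>z. delbar \<Omega> z [a, b, d]) z y = \<i> *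
    (?L y b a d - ?L y d a b - ?L y a b d + ?L y d b a + ?L y a d b - ?L y b d a)" for a b d y
  proof -
    have "diff_lin (\<lambda>z. delbar \<Omega> z [a, b, d]) z = diff_lin (\<lambda>z. \<i> *
      (T z b a d - T z d a b - T z a b d + T z d b a + T z a d b - T z b d a)) z"
      using z by (intro diff_lin_cong_open[of "- {0}"]) (auto simp: delbar_\<Omega>)
    moreover have "\<dots> y = \<i> *
      (?L y b a d - ?L y d a b - ?L y a b d + ?L y d b a + ?L y a d b - ?L y b d a)"
      by (subst diff_lin_eq)
        (rule has_wirtinger_mult has_wirtinger_const has_wirtinger_diff has_wirtinger_add
          has_wirtinger_T z | simp)+
    ultimately show ?thesis by simp
  qed
  show ?thesis
    \<comment> \<open>After the \<open>K\<close> terms cancel, the remaining terms contain two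
      factors \<open>sg\<close> and change sign under exchanging their arguments; they vanish
      because \<sigma> \<and> \<sigma> = 0, that is, (\<partial>\<partial>bar u)^2 = 0.\<close>
    using K_sym[OF z, of v\<^sub>1 v\<^sub>0] K_sym[OF z, of v\<^sub>2 v\<^sub>0] K_sym[OF z, of v\<^sub>2 v\<^sub>1]
      K_sym[OF z, of v\<^sub>3 v\<^sub>0] K_sym[OF z, of v\<^sub>3 v\<^sub>1] K_sym[OF z, of v\<^sub>3 v\<^sub>2]
    by (simp add: del_def * vs numeral_2_eq_2 numeral_3_eq_3 lessThan_Suc algebra_simps)
qed

section \<open>Descent to the Hopf surface\<close>

text \<open>The exponents satisfy k1 (ln |\<alpha>| + ln |\<beta>|) = ln |\<alpha>|, and likewise
  for k2 and \<beta>.\<close>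

lemma scale_powr:
  "(cmod (\<alpha> powi n) * cmod (\<beta> powi n)) powr (- 2 * k\<^sub>1) = 1 / (cmod (\<alpha> powi n))\<^sup>2"
  "(cmod (\<alpha> powi n) * cmod (\<beta> powi n)) powr (- 2 * k\<^sub>2) = 1 / (cmod (\<beta> powi n))\<^sup>2"
proof -
  have pos: "cmod \<alpha> > 0" "cmod \<beta> > 0" using \<alpha> \<beta> by linarith+
  have exp: "cmod (\<alpha> powi n) = exp (of_int n * ln (cmod \<alpha>))" "cmod (\<beta> powi n) = exp (of_int n * ln (cmod \<beta>))"
    using pos by (simp_all add: norm_power_int powr_def flip: powr_real_of_int')
  have "ln (cmod \<alpha>) + ln (cmod \<beta>) \<noteq> 0" using ln_pos by linarith
  then show "(cmod (\<alpha> powi n) * cmod (\<beta> powi n)) powr (- 2 * k\<^sub>1) = 1 / (cmod (\<alpha> powi n))\<^sup>2"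
    "(cmod (\<alpha> powi n) * cmod (\<beta> powi n)) powr (- 2 * k\<^sub>2) = 1 / (cmod (\<beta> powi n))\<^sup>2"
    unfolding exp exp_add[symmetric] distrib_left[symmetric]
    by (simp_all add: powr_def hopf_k1_def hopf_k2_def exp_minus inverse_eq_divide flip: exp_double)
qed

lemma nonzero: "\<alpha> \<noteq> 0" "\<beta> \<noteq> 0"
  using \<alpha> \<beta> by auto

lemma hopf_act_nonzero: "z \<noteq> 0 \<Longrightarrow> hopf_act \<alpha> \<beta> n z \<noteq> 0"
  using nonzero by (auto simp: vec2_eq_iff)

text \<open>By uniqueness: the rescaled value solves the defining equation at the image
  point.\<close>

lemma phi_act:
  assumes z: "z \<noteq> 0"
  shows "\<Phi> (hopf_act \<alpha> \<beta> n z) = cmod (\<alpha> powi n) * cmod (\<beta> powi n) * \<Phi> z"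
proof (rule phi_eqI)
  show "hopf_act \<alpha> \<beta> n z \<noteq> 0" using z by (rule hopf_act_nonzero)
  show "cmod (\<alpha> powi n) * cmod (\<beta> powi n) * \<Phi> z > 0"
    using nonzero phi_pos[OF z] by simp
  have "F (hopf_act \<alpha> \<beta> n z) (cmod (\<alpha> powi n) * cmod (\<beta> powi n) * \<Phi> z) = F z (\<Phi> z)"
    unfolding F_def powr_mult[of "cmod (\<alpha> powi n) * cmod (\<beta> powi n)"] scale_powr hopf_act_nth norm_mult power_mult_distrib
    using nonzero by simp
  then show "F (hopf_act \<alpha> \<beta> n z) (cmod (\<alpha> powi n) * cmod (\<beta> powi n) * \<Phi> z) = 1"
    by (simp add: F_phi_eq[OF z])
qed

lemma PQ_act:
  assumes "z \<noteq> 0"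
  shows "P (hopf_act \<alpha> \<beta> n z) = P z / (cmod (\<alpha> powi n))\<^sup>2"
    and "Q (hopf_act \<alpha> \<beta> n z) = Q z / (cmod (\<beta> powi n))\<^sup>2"
  unfolding P_def Q_def phi_act[OF assms] powr_mult[of "cmod (\<alpha> powi n) * cmod (\<beta> powi n)"] scale_powr by simp_all

lemma D_act: "z \<noteq> 0 \<Longrightarrow> D (hopf_act \<alpha> \<beta> n z) = D z"
  using nonzero by (simp add: D_def PQ_act norm_mult power_mult_distrib)

lemma du_act:
  assumes "z \<noteq> 0"
  shows "du (hopf_act \<alpha> \<beta> n z) (hopf_act \<alpha> \<beta> n v) = du z v"
  using nonzero unfolding du_def D_act[OF assms] PQ_act[OF assms]
  by (simp only: of_real_divide complex_norm_square hopf_act_nth complex_cnj_mult) simp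

lemma sg_act: "sg (hopf_act \<alpha> \<beta> n z) (hopf_act \<alpha> \<beta> n v) = \<alpha> powi n * \<beta> powi n * sg z v"
  by (simp add: sg_def algebra_simps)

lemma c_act:
  assumes "z \<noteq> 0"
  shows "c (hopf_act \<alpha> \<beta> n z) =
    c z / (\<alpha> powi n * cnj (\<alpha> powi n) * (\<beta> powi n * cnj (\<beta> powi n)))"
  unfolding c_def D_act[OF assms] PQ_act[OF assms]
  by (simp only: of_real_divide of_real_mult complex_norm_square) (simp add: mult_ac)

text \<open>\<open>sg\<close> scales by the nth power of \<alpha>\<beta> and \<open>c\<close> by the
  inverse of the squared modulus of that factor, while \<open>du\<close> is invariant.\<close>

lemma H_act:
  assumes "z \<noteq> 0"
  shows "H (hopf_act \<alpha> \<beta> n z) (hopf_act \<alpha> \<beta> n v) (hopf_act \<alpha> \<beta> n w) = H z v w"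
  using nonzero
  unfolding H_def c_act[OF assms] sg_act du_act[OF assms] by simp

text \<open>Invariance is read off the explicit formula \<open>\<Omega>\<close>, avoiding naturality
  of \<partial> and \<partial>bar.\<close>

lemma hopf_cover_form_act:
  assumes "z \<noteq> 0"
  shows "hopf_cover_form \<alpha> \<beta> (hopf_act \<alpha> \<beta> n z) (map (hopf_act \<alpha> \<beta> n) vs) = hopf_cover_form \<alpha> \<beta> z vs"
  using assms by (simp add: hopf_cover_form_eq hopf_act_nonzero \<Omega>_def H_act)

theorem gauduchon_condition_hopf:
  "gauduchon_condition (hopf_atlas \<alpha> \<beta>) (gauduchon_ornea_form \<alpha> \<beta>)"
  unfolding gauduchon_condition_def mform_vanishes_def
proof clarify
  fix W \<phi> x vs q
  assume "(W, \<phi>) \<in> hopf_atlas \<alpha> \<beta>" and q: "q \<in> W"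
  then obtain U where U: "open U" "0 \<notin> U" "inj_on (hopf_proj \<alpha> \<beta>) U"
    and W: "W = hopf_proj \<alpha> \<beta> ` U" and \<phi>: "\<phi> = inv_into U (hopf_proj \<alpha> \<beta>)"
    by (auto simp: hopf_atlas_def)
  have \<phi>q: "\<phi> q \<in> U" using q U unfolding W \<phi> by auto
  have form: "gauduchon_ornea_form \<alpha> \<beta> (W, \<phi>) x us = \<Omega> x us" if "x \<in> U" for x us
  proof -
    have "x \<noteq> 0" using that U by auto
    then show ?thesis
      using descend_hopf_proj[of \<alpha> \<beta> "hopf_cover_form \<alpha> \<beta>", OF nonzero hopf_cover_form_act U that]
      by (simp add: gauduchon_ornea_form_def W \<phi> hopf_cover_form_eq)
  qed
  \<comment> \<open>The chart expression is known only on the open set \<open>U\<close>, which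
    suffices since both operators are local.\<close>
  have "mdel (mdelbar (gauduchon_ornea_form \<alpha> \<beta>)) (W, \<phi>) (\<phi> q) vs = del (delbar \<Omega>) (\<phi> q) vs"
    unfolding mdel_def mdelbar_def
    by (intro del_cong_open[OF U(1) \<phi>q] delbar_cong_open[OF U(1)] form)
  also have "\<dots> = 0"
    using \<phi>q U by (intro del_delbar_\<Omega>) auto
  finally show "mdel (mdelbar (gauduchon_ornea_form \<alpha> \<beta>)) (W, \<phi>) (\<phi> q) vs = 0" .
qed

end

theorem corollary2p5:
  fixes \<alpha> \<beta> :: complex
  assumes "1 < cmod \<alpha>" and "cmod \<alpha> \<le> cmod \<beta>"
  shows "gauduchon_condition (hopf_atlas \<alpha> \<beta>) (gauduchon_ornea_form \<alpha> \<beta>)"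
proof -
  interpret class_1_hopf \<alpha> \<beta>
    using assms by unfold_locales auto
  show ?thesis by (rule gauduchon_condition_hopf)
qed

end
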